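(* Let $n\in\mathbb N$ and $F\in\mathcal B_c$. Let $h\in\mathcal{IBV}^{n-1}$ be such that $h^{(n-1)}$ is a monotonic function. Then $$\int_{-\infty}^\infty F^{(n)}h=(-1)^{n-1}\Bigl[h^{(n-1)}(-\infty)\int_{-\infty}^\xi F'+h^{(n-1)}(\infty)\int_\xi^\infty F'\Bigr]$$ for some $\xi\in\overline{\mathbb R}$.
   Context: Write $\overline{\mathbb R}=[-\infty,\infty]$. $\mathcal B_c$ is the space of continuous functions $F:\overline{\mathbb R}\to\mathbb R$ (continuous on $\mathbb R$ with $F(\pm\infty)=\lim_{x\to\pm\infty}F(x)\in\mathbb R$) with $F(-\infty)=0$; $F^{(n)}$ is the $n$th distributional derivative, and $F$ is uniquely determined by $F^{(n)}$. $\mathcal{BV}$ is the set of functions $g:\overline{\mathbb R}\to\mathbb R$ of bounded variation, with the convention $g(\pm\infty)=\lim_{x\to\pm\infty}g(x)$. For locally integrable $q$, $I^0[q]=q$ and $I^m[q](x)=\int_0^xI^{m-1}[q](t)\,dt$; $\mathcal{IBV}^0=\mathcal{BV}$ and $\mathcal{IBV}^m=\{I^m[g]:g\in\mathcal{BV}\}$ for $m\ge1$. For $h=I^{n-1}[g]\in\mathcal{IBV}^{n-1}$ with $g\in\mathcal{BV}$, $h^{(n-1)}$ denotes $g$ (for $n\ge2$, $g$ is determined by $h$ up to a countable set, which does not affect the integral below). The integral is $$\int_{-\infty}^\infty F^{(n)}h=(-1)^{n-1}\Bigl[F(\infty)g(\infty)-\int_{-\infty}^\infty F(x)\,dg(x)\Bigr],$$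 where $\int_{-\infty}^\infty F\,dg$ is a Riemann--Stieltjes integral over $\overline{\mathbb R}$ (the limit of Riemann--Stieltjes integrals over $[a,b]$ as $a\to-\infty$, $b\to\infty$). For $-\infty\le a\le b\le\infty$, $\int_a^bF'=F(b)-F(a)$. *)

theory Defs
  imports "HOL-Analysis.Analysis"
begin

definition test_functions :: "(real \<Rightarrow> real) set" where
  "test_functions = {\<phi>. (\<forall>k x. (deriv ^^ k) \<phi> differentiable (at x)) \<and>
                         compact (closure {x. \<phi> x \<noteq> 0})}"

text \<open>A distribution is represented by its action on test functions, and is
  \<^const>\<open>undefined\<close> elsewhere, so that equality of distributions is equality of functions.\<close>

type_synonym distribution = "(real \<Rightarrow> real) \<Rightarrow> real"

definition distr_of :: "(real \<Rightarrow> real) \<Rightarrow> distribution" where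
  "distr_of f = (\<lambda>\<phi>\<in>test_functions. LINT x|lborel. f x * \<phi> x)"

definition distr_deriv :: "distribution \<Rightarrow> distribution" where
  "distr_deriv T = (\<lambda>\<phi>\<in>test_functions. - T (deriv \<phi>))"

text \<open>The order topology of \<^typ>\<open>ereal\<close> is that of the two-point compactification, so
  continuity on \<^term>\<open>UNIV :: ereal set\<close> includes \<open>F(\<plusminus>\<infinity>) = lim F(x)\<close>.\<close>

definition Bc :: "(ereal \<Rightarrow> real) set" where
  "Bc = {F. continuous_on UNIV F \<and> F (-\<infinity>) = 0}"

definition nth_deriv :: "nat \<Rightarrow> (ereal \<Rightarrow> real) \<Rightarrow> distribution" where
  "nth_deriv n F = (distr_deriv ^^ n) (distr_of (\<lambda>x. F (ereal x)))"

definition primitive :: "nat \<Rightarrow> distribution \<Rightarrow> ereal \<Rightarrow> real" where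
  "primitive n T = (THE F. F \<in> Bc \<and> nth_deriv n F = T)"

definition bounded_variation :: "(ereal \<Rightarrow> real) \<Rightarrow> bool" where
  "bounded_variation g \<longleftrightarrow>
     (\<exists>M. \<forall>(x :: nat \<Rightarrow> ereal) N. mono x \<longrightarrow> (\<Sum>i<N. \<bar>g (x (Suc i)) - g (x i)\<bar>) \<le> M)"

definition BV :: "(ereal \<Rightarrow> real) set" where
  "BV = {g. bounded_variation g \<and>
            ((\<lambda>x. g (ereal x)) \<longlongrightarrow> g \<infinity>) at_top \<and>
            ((\<lambda>x. g (ereal x)) \<longlongrightarrow> g (-\<infinity>)) at_bot}"

primrec iter_int :: "nat \<Rightarrow> (real \<Rightarrow> real) \<Rightarrow> real \<Rightarrow> real" where
  "iter_int 0 q = q"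
| "iter_int (Suc m) q = (\<lambda>x. LBINT t=ereal 0..ereal x. iter_int m q t)"

text \<open>Elements of \<open>IBV m\<close> are recorded on the real line only: for \<open>m = 0\<close> the values at
  \<open>\<plusminus>\<infinity>\<close> are determined by those on the real line, and for \<open>m > 0\<close> limits at
  \<open>\<plusminus>\<infinity>\<close> need not exist.  \<open>IBV_deriv m h g\<close> says that \<open>g\<close> is (a version of) \<open>h\<^sup>(\<^sup>m\<^sup>)\<close>.\<close>

definition IBV_deriv :: "nat \<Rightarrow> (real \<Rightarrow> real) \<Rightarrow> (ereal \<Rightarrow> real) \<Rightarrow> bool" where
  "IBV_deriv m h g \<longleftrightarrow> g \<in> BV \<and> h = iter_int m (\<lambda>x. g (ereal x))"

definition IBV :: "nat \<Rightarrow> (real \<Rightarrow> real) set" where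
  "IBV m = {h. \<exists>g. IBV_deriv m h g}"

text \<open>The cells \<open>K\<close> are the intervals \<open>[Inf K, Sup K]\<close>; degenerate ones contribute 0.\<close>

definition has_RS_integral ::
    "(real \<Rightarrow> real) \<Rightarrow> (real \<Rightarrow> real) \<Rightarrow> real \<Rightarrow> real \<Rightarrow> real \<Rightarrow> bool" where
  "has_RS_integral f g a b s \<longleftrightarrow>
     (\<forall>\<epsilon>>0. \<exists>\<delta>>0. \<forall>p. p tagged_division_of {a..b} \<and> (\<forall>(x, K)\<in>p. Sup K - Inf K < \<delta>) \<longrightarrow>
        \<bar>(\<Sum>(x, K)\<in>p. f x * (g (Sup K) - g (Inf K))) - s\<bar> < \<epsilon>)"

definition has_RS_integral_ereal :: "(ereal \<Rightarrow> real) \<Rightarrow> (ereal \<Rightarrow> real) \<Rightarrow> real \<Rightarrow> bool" where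
  "has_RS_integral_ereal F g s \<longleftrightarrow>
     (\<exists>J. (\<forall>a b. a < b \<longrightarrow>
             has_RS_integral (\<lambda>x. F (ereal x)) (\<lambda>x. g (ereal x)) a b (J a b)) \<and>
          ((\<lambda>(a, b). J a b) \<longlongrightarrow> s) (at_bot \<times>\<^sub>F at_top))"

text \<open>The integral of the product of \<open>T = F\<^sup>(\<^sup>n\<^sup>)\<close> and \<open>h \<in> IBV (n - 1)\<close> over the extended real
  line.  For \<open>n \<ge> 2\<close>, \<open>h\<close> determines \<open>g\<close> up to a countable set only, which does not
  affect the value.\<close>

definition distr_integral_prod :: "nat \<Rightarrow> distribution \<Rightarrow> (real \<Rightarrow> real) \<Rightarrow> real" where
  "distr_integral_prod n T h =
     (THE v. \<exists>g s. IBV_deriv (n - 1) h g \<and> has_RS_integral_ereal (primitive n T) g s \<and>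
                   v = (-1) ^ (n - 1) * (primitive n T \<infinity> * g \<infinity> - s))"

definition distr_integral :: "distribution \<Rightarrow> ereal \<Rightarrow> ereal \<Rightarrow> real" where
  "distr_integral T a b = primitive 1 T b - primitive 1 T a"

end

theory Submission
  imports Defs
begin

text \<open>
  For monotone increasing \<open>g\<close> put \<open>\<gamma>(y) = sup {x. g x \<le> y}\<close>. If \<open>g u \<le> y < g v\<close> then \<open>\<gamma>(y)\<close> lies
  in \<open>[u, v]\<close>, so Riemann--Stieltjes sums of \<open>F\<close> against \<open>g\<close> differ little from the ordinary
  integral of \<open>F \<circ> \<gamma>\<close> over \<open>[g(a), g(b)]\<close>. Hence the Stieltjes integral over the extended real
  line exists and equals the integral of \<open>F \<circ> \<gamma>\<close> over \<open>[g(-\<infinity>), g(\<infinity>)]\<close>, which by the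
  intermediate value theorem is \<open>F(\<xi>) (g(\<infinity>) - g(-\<infinity>))\<close> for some \<open>\<xi>\<close>. A decreasing \<open>g\<close> is
  treated through \<open>-g\<close>.

  The value does not depend on the choice of \<open>g\<close>: two functions of bounded variation with the
  same iterated integral agree outside a countable set, and Riemann--Stieltjes sums may be formed
  over divisions avoiding that set. Finally \<open>F\<close> is recovered from \<open>F\<^sup>(\<^sup>n\<^sup>)\<close>: if the difference \<open>D\<close> of
  two candidates annihilates all \<open>\<phi>\<^sup>(\<^sup>n\<^sup>)\<close>, then by translation towards \<open>-\<infinity>\<close>, where \<open>D\<close> tends to 0,
  it annihilates all \<open>\<phi>\<^sup>(\<^sup>n\<^sup>-\<^sup>1\<^sup>)\<close>, and inductively all test functions.
\<close>

section \<open>Riemann--Stieltjes integrals against monotone functions\<close>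

text \<open>The supremum is taken in \<open>ereal\<close>, so it exists for every \<open>y\<close>;
  where no \<open>x\<close> satisfies \<open>g x \<le> y\<close> its value is -\<infinity>.\<close>

definition upper_inverse :: "(ereal \<Rightarrow> real) \<Rightarrow> real \<Rightarrow> ereal" where
  "upper_inverse g y = Sup {x. g x \<le> y}"

lemma mono_upper_inverse: "mono (upper_inverse g)"
  unfolding upper_inverse_def by (intro monoI Sup_subset_mono) auto

lemma upper_inverse_ge: "g u \<le> y \<Longrightarrow> u \<le> upper_inverse g y"
  unfolding upper_inverse_def by (intro Sup_upper) auto

lemma upper_inverse_le:
  assumes "mono g" "y < g v"
  shows "upper_inverse g y \<le> v"
  unfolding upper_inverse_def
proof (rule Sup_least)
  fix x assume "x \<in> {x. g x \<le> y}"
  then have "\<not> v \<le> x" using assms by (auto dest: monoD)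
  then show "x \<le> v" by simp
qed

text \<open>Sets of the form \<open>{x. y < f x}\<close> are upward closed for monotone
  \<open>f\<close>, hence intervals, hence Borel.\<close>

lemma borel_measurable_mono_ereal:
  fixes f :: "real \<Rightarrow> ereal"
  assumes "mono f"
  shows "f \<in> borel_measurable borel"
proof (rule borel_measurableI_greater)
  fix y
  have "is_interval {x. y < f x}"
    unfolding is_interval_1 using assms by (auto dest!: monoD intro: less_le_trans)
  then show "{x \<in> space borel. y < f x} \<in> sets borel"
    by (simp add: real_interval_borel_measurable)
qed

lemma bounded_continuous_ereal:
  fixes F :: "ereal \<Rightarrow> real"
  assumes "continuous_on UNIV F"
  obtains B where "B > 0" "\<And>x. \<bar>F x\<bar> \<le> B"
proof -
  have "bounded (range F)"
    by (intro compact_imp_bounded compact_continuous_image assms compact_UNIV)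
  then show ?thesis using that by (auto simp: bounded_pos)
qed

lemma integrable_on_compose_upper_inverse:
  fixes F :: "ereal \<Rightarrow> real"
  assumes "continuous_on UNIV F"
  shows "(\<lambda>y. F (upper_inverse g y)) integrable_on {c..d}"
proof -
  obtain B where B: "\<And>x. \<bar>F x\<bar> \<le> B" using bounded_continuous_ereal[OF assms] by blast
  have [measurable]: "F \<in> borel_measurable borel"
    using assms by (rule borel_measurable_continuous_onI)
  have [measurable]: "upper_inverse g \<in> borel_measurable borel"
    by (intro borel_measurable_mono_ereal mono_upper_inverse)
  have "set_integrable lborel {c..d} (\<lambda>y. F (upper_inverse g y))"
    unfolding set_integrable_def
    by (rule integrableI_bounded_set_indicator[where B = B]) (auto simp: B emeasure_lborel_Icc_eq)
  then show ?thesis by (rule set_borel_integral_eq_integral)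
qed


text \<open>On a cell [u, v], \<open>upper_inverse g\<close> maps [g u, g v) into [u, v]. So the
  Stieltjes term of the cell differs from the integral of \<open>F (upper_inverse g y)\<close> over
  [g u, g v] by at most the oscillation of \<open>F\<close> on the cell times
  \<open>g v - g u\<close>. Uniform continuity bounds the oscillation, and the increments of
  \<open>g\<close> telescope.\<close>

lemma has_RS_integral_mono:
  fixes F g :: "ereal \<Rightarrow> real"
  assumes F: "continuous_on UNIV F" and g: "mono g" and ab: "a < b"
  shows "has_RS_integral (\<lambda>x. F (ereal x)) (\<lambda>x. g (ereal x)) a b
           (integral {g (-\<infinity>)..g b} (\<lambda>y. F (upper_inverse g y)) -
            integral {g (-\<infinity>)..g a} (\<lambda>y. F (upper_inverse g y)))"
  unfolding has_RS_integral_def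
proof (intro allI impI)
  fix \<epsilon> :: real
  assume "\<epsilon> > 0"
  define f where "f y = F (upper_inverse g y)" for y
  define \<Psi> where "\<Psi> t = integral {g (-\<infinity>)..g (ereal t)} f" for t
  have gmono: "g x \<le> g y" if "x \<le> y" for x y using g that by (rule monoD)
  \<comment> \<open>The summand 1 keeps the denominator positive when
    \<open>g a = g b\<close>.\<close>
  define \<eta> where "\<eta> = \<epsilon> / (g b - g a + 1)"
  have "g a \<le> g b" using ab by (intro gmono) simp
  then have \<eta>: "\<eta> > 0" "\<eta> * (g b - g a) < \<epsilon>"
    using \<open>\<epsilon> > 0\<close> by (auto simp: \<eta>_def field_simps)
  have fint: "f integrable_on {c..d}" for c d
    unfolding f_def by (rule integrable_on_compose_upper_inverse[OF F])
  have "continuous_on {a..b} (\<lambda>x. F (ereal x))"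
    using continuous_on_compose2[OF F continuous_on_ereal[OF continuous_on_id]] by auto
  then have "uniformly_continuous_on {a..b} (\<lambda>x. F (ereal x))"
    by (intro compact_uniformly_continuous) auto
  then obtain \<delta> where "\<delta> > 0"
    and \<delta>: "\<And>x z. x \<in> {a..b} \<Longrightarrow> z \<in> {a..b} \<Longrightarrow> \<bar>z - x\<bar> < \<delta> \<Longrightarrow> \<bar>F (ereal z) - F (ereal x)\<bar> < \<eta>"
    using \<eta>(1) unfolding uniformly_continuous_on_def dist_real_def by metis
  have cell: "\<bar>F (ereal x) * (g v - g u) - (\<Psi> v - \<Psi> u)\<bar> \<le> \<eta> * (g v - g u)"
    if "a \<le> u" "u \<le> x" "x \<le> v" "v \<le> b" "v - u < \<delta>" for x u v :: real
  proof -
    have guv: "g u \<le> g v" using that by (intro gmono) simp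
    have "\<Psi> u + integral {g u..g v} f = \<Psi> v"
      unfolding \<Psi>_def by (rule Henstock_Kurzweil_Integration.integral_combine) (auto simp: guv gmono fint)
    then have \<Psi>uv: "integral {g u..g v} f = \<Psi> v - \<Psi> u" by simp
    have "((\<lambda>y. F (ereal x) - f y) has_integral (F (ereal x) * (g v - g u) - (\<Psi> v - \<Psi> u)))
                 (cbox (g u) (g v))"
      using has_integral_diff[OF has_integral_const_real[of "F (ereal x)"] integrable_integral[OF fint], of "g u" "g v"]
        guv unfolding \<Psi>uv by (simp add: mult.commute)
    \<comment> \<open>The endpoint \<open>g v\<close> is left out: if \<open>g\<close> is constant
      to the right of \<open>v\<close>, then \<open>upper_inverse g (g v)\<close> lies beyond
      \<open>v\<close>. A single point does not affect the integral.\<close>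
    moreover have "norm (F (ereal x) - f y) \<le> \<eta>" if y: "y \<in> cbox (g u) (g v) - {g v}" for y
    proof -
      have "ereal u \<le> upper_inverse g y" "upper_inverse g y \<le> ereal v"
        using y by (auto intro: upper_inverse_ge upper_inverse_le[OF g])
      moreover obtain z where z: "upper_inverse g y = ereal z"
        using calculation by (cases "upper_inverse g y") auto
      ultimately have "u \<le> z" "z \<le> v" by auto
      then have "\<bar>F (ereal x) - F (ereal z)\<bar> < \<eta>"
        using that(1) \<open>a \<le> u\<close> \<open>u \<le> x\<close> \<open>x \<le> v\<close> \<open>v \<le> b\<close> \<open>v - u < \<delta>\<close> by (intro \<delta>) auto
      then show ?thesis by (simp add: f_def z)
    qed
    ultimately have "norm (F (ereal x) * (g v - g u) - (\<Psi> v - \<Psi> u)) \<le> \<eta> * measure lborel (cbox (g u) (g v))"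
      using \<eta>(1) by (intro has_integral_bound_spike_finite[of \<eta> "{g v}"]) auto
    then show ?thesis using guv by simp
  qed
  show "\<exists>\<delta>>0. \<forall>p. p tagged_division_of {a..b} \<and> (\<forall>(x, K)\<in>p. Sup K - Inf K < \<delta>) \<longrightarrow>
          \<bar>(\<Sum>(x, K)\<in>p. F (ereal x) * (g (ereal (Sup K)) - g (ereal (Inf K)))) -
            (integral {g (-\<infinity>)..g b} (\<lambda>y. F (upper_inverse g y)) -
             integral {g (-\<infinity>)..g a} (\<lambda>y. F (upper_inverse g y)))\<bar> < \<epsilon>"
  proof (intro exI[of _ \<delta>] conjI allI impI \<open>\<delta> > 0\<close>, elim conjE)
    fix p
    assume p: "p tagged_division_of {a..b}" and fine: "\<forall>(x, K)\<in>p. Sup K - Inf K < \<delta>"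
    let ?S = "\<Sum>(x, K)\<in>p. F (ereal x) * (g (ereal (Sup K)) - g (ereal (Inf K)))"
    have \<Psi>: "(\<Sum>(x, K)\<in>p. \<Psi> (Sup K) - \<Psi> (Inf K)) = \<Psi> b - \<Psi> a"
      and G: "(\<Sum>(x, K)\<in>p. g (ereal (Sup K)) - g (ereal (Inf K))) = g b - g a"
      using additive_tagged_division_1[OF _ p] ab by simp_all
    have "?S - (\<Psi> b - \<Psi> a) =
        (\<Sum>(x, K)\<in>p. F (ereal x) * (g (ereal (Sup K)) - g (ereal (Inf K))) - (\<Psi> (Sup K) - \<Psi> (Inf K)))"
      unfolding \<Psi>[symmetric] by (simp add: sum_subtractf case_prod_unfold)
    also have "\<bar>\<dots>\<bar> \<le> (\<Sum>(x, K)\<in>p. \<eta> * (g (ereal (Sup K)) - g (ereal (Inf K))))"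
      unfolding real_norm_def[symmetric]
    proof (rule sum_norm_le, safe)
      fix x K
      assume xK: "(x, K) \<in> p"
      obtain u v where uv: "K = {u..v}" using tagged_division_ofD(4)[OF p xK] by auto
      have "x \<in> K" "K \<subseteq> {a..b}" using tagged_division_ofD(2,3)[OF p xK] by auto
      moreover have "Sup K - Inf K < \<delta>" using fine xK by auto
      ultimately show "norm (F (ereal x) * (g (ereal (Sup K)) - g (ereal (Inf K))) - (\<Psi> (Sup K) - \<Psi> (Inf K)))
          \<le> \<eta> * (g (ereal (Sup K)) - g (ereal (Inf K)))"
        using uv cell[of u x v] by auto
    qed
    also have "\<dots> = \<eta> * (g b - g a)"
      unfolding G[symmetric] sum_distrib_left by (simp add: case_prod_unfold)
    also have "\<dots> < \<epsilon>" by (rule \<eta>)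
    finally show "\<bar>?S - (integral {g (-\<infinity>)..g b} (\<lambda>y. F (upper_inverse g y)) -
             integral {g (-\<infinity>)..g a} (\<lambda>y. F (upper_inverse g y)))\<bar> < \<epsilon>"
      by (simp add: \<Psi>_def f_def[abs_def])
  qed
qed

text \<open>The indefinite integral is continuous in its upper limit, and membership in
  \<open>BV\<close> makes \<open>g\<close> converge to its values at both infinite ends, so the
  integrals over [a, b] converge.\<close>

lemma has_RS_integral_ereal_mono:
  fixes F g :: "ereal \<Rightarrow> real"
  assumes F: "continuous_on UNIV F" and g: "mono g" and "g \<in> BV"
  shows "has_RS_integral_ereal F g (integral {g (-\<infinity>)..g \<infinity>} (\<lambda>y. F (upper_inverse g y)))"
proof -
  define \<Psi> where "\<Psi> t = integral {g (-\<infinity>)..t} (\<lambda>y. F (upper_inverse g y))" for t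
  have cont: "continuous_on {g (-\<infinity>)..g \<infinity>} \<Psi>"
    unfolding \<Psi>_def
    by (intro indefinite_integral_continuous_1 integrable_on_compose_upper_inverse F)
  have rng: "g (-\<infinity>) \<le> g x" "g x \<le> g \<infinity>" for x using monoD[OF g] by auto
  have top: "((\<lambda>x. \<Psi> (g (ereal x))) \<longlongrightarrow> \<Psi> (g \<infinity>)) at_top"
    using \<open>g \<in> BV\<close> by (intro continuous_on_tendsto_compose[OF cont]) (auto simp: BV_def rng)
  have bot: "((\<lambda>x. \<Psi> (g (ereal x))) \<longlongrightarrow> \<Psi> (g (-\<infinity>))) at_bot"
    using \<open>g \<in> BV\<close> by (intro continuous_on_tendsto_compose[OF cont]) (auto simp: BV_def rng)
  have "((\<lambda>(a, b). \<Psi> (g (ereal b)) - \<Psi> (g (ereal a))) \<longlongrightarrow> \<Psi> (g \<infinity>) - \<Psi> (g (-\<infinity>)))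
      (at_bot \<times>\<^sub>F at_top)"
    unfolding case_prod_unfold
    by (rule tendsto_diff[OF filterlim_compose[OF top filterlim_snd] filterlim_compose[OF bot filterlim_fst]])
  moreover have "\<Psi> (g (-\<infinity>)) = 0" by (simp add: \<Psi>_def)
  ultimately show ?thesis
    unfolding has_RS_integral_ereal_def
    by (intro exI[of _ "\<lambda>a b. \<Psi> (g (ereal b)) - \<Psi> (g (ereal a))"])
       (auto simp: \<Psi>_def intro!: has_RS_integral_mono[OF F g])
qed

text \<open>\<open>ereal\<close> is compact and connected: \<open>F\<close> attains a minimum and a
  maximum, which bound the integral, and it takes every value between them.\<close>

lemma RS_mean_value_mono:
  fixes F g :: "ereal \<Rightarrow> real"
  assumes F: "continuous_on UNIV F" and g: "mono g" and "g \<in> BV"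
  shows "\<exists>\<xi>. has_RS_integral_ereal F g (F \<xi> * (g \<infinity> - g (-\<infinity>)))"
proof -
  define s where "s = integral {g (-\<infinity>)..g \<infinity>} (\<lambda>y. F (upper_inverse g y))"
  have le: "g (-\<infinity>) \<le> g \<infinity>" using g by (rule monoD) simp
  obtain m where m: "\<And>x. F m \<le> F x" using continuous_attains_inf[OF compact_UNIV _ F] by auto
  obtain M where M: "\<And>x. F x \<le> F M" using continuous_attains_sup[OF compact_UNIV _ F] by auto
  have int: "(\<lambda>y. F (upper_inverse g y)) integrable_on {g (-\<infinity>)..g \<infinity>}"
    by (rule integrable_on_compose_upper_inverse[OF F])
  have "F m * (g \<infinity> - g (-\<infinity>)) \<le> s"
    using integral_le[OF integrable_const_ivl int, of "F m"] le by (simp add: s_def m mult.commute)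
  moreover have "s \<le> F M * (g \<infinity> - g (-\<infinity>))"
    using integral_le[OF int integrable_const_ivl, of "F M"] le by (simp add: s_def M mult.commute)
  ultimately obtain \<xi> where "s = F \<xi> * (g \<infinity> - g (-\<infinity>))"
  \<comment> \<open>If the total increment of \<open>g\<close> is zero, the two bounds force
    \<open>s = 0\<close> and any \<open>\<xi>\<close> serves.\<close>
  proof (cases "g \<infinity> = g (-\<infinity>)")
    case False
    then have "g \<infinity> - g (-\<infinity>) > 0" using le by simp
    moreover have "is_interval (range F)"
      by (intro is_interval_connected_1[THEN iffD2] connected_continuous_image F connectedI_interval) auto
    moreover have "F m \<le> s / (g \<infinity> - g (-\<infinity>))" "s / (g \<infinity> - g (-\<infinity>)) \<le> F M"
      using calculation(1) \<open>F m * _ \<le> s\<close> \<open>s \<le> F M * _\<close> by (simp_all add: field_simps)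
    ultimately have "s / (g \<infinity> - g (-\<infinity>)) \<in> range F"
      unfolding is_interval_1 by blast
    then obtain \<xi> where "s / (g \<infinity> - g (-\<infinity>)) = F \<xi>" by blast
    then have "s = F \<xi> * (g \<infinity> - g (-\<infinity>))" using False by (simp add: field_simps)
    then show ?thesis by (rule that)
  qed auto
  then show ?thesis
    using has_RS_integral_ereal_mono[OF assms] by (auto simp: s_def intro!: exI[of _ \<xi>])
qed

lemma has_RS_integral_minus:
  assumes "has_RS_integral f k a b c"
  shows "has_RS_integral f (\<lambda>x. - k x) a b (- c)"
proof -
  have eq1: "(\<Sum>(x, K)\<in>p. f x * (- k (Sup K) - - k (Inf K))) = - (\<Sum>(x, K)\<in>p. f x * (k (Sup K) - k (Inf K)))"
   for p :: "(real \<times> real set) set"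
    by (subst sum_negf[symmetric], rule sum.cong[OF refl]) (clarsimp simp: right_diff_distrib)
  have eq2: "\<bar>- s - - c\<bar> = \<bar>s - c\<bar>" for s :: real by linarith
  show ?thesis using assms unfolding has_RS_integral_def eq1 eq2 .
qed

lemma has_RS_integral_ereal_minus:
  assumes "has_RS_integral_ereal F g s"
  shows "has_RS_integral_ereal F (\<lambda>x. - g x) (- s)"
proof -
  obtain J where J: "\<And>a b. a < b \<Longrightarrow> has_RS_integral (\<lambda>x. F (ereal x)) (\<lambda>x. g (ereal x)) a b (J a b)"
    and lim: "((\<lambda>(a, b). J a b) \<longlongrightarrow> s) (at_bot \<times>\<^sub>F at_top)"
    using assms unfolding has_RS_integral_ereal_def by blast
  have "has_RS_integral (\<lambda>x. F (ereal x)) (\<lambda>x. - g (ereal x)) a b (- J a b)" if "a < b" for a b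
    using J[OF that] by (rule has_RS_integral_minus)
  moreover have "((\<lambda>(a, b). - J a b) \<longlongrightarrow> - s) (at_bot \<times>\<^sub>F at_top)"
    using tendsto_minus[OF lim] by (simp add: case_prod_unfold)
  ultimately show ?thesis
    unfolding has_RS_integral_ereal_def by (intro exI[of _ "\<lambda>a b. - J a b"]) simp
qed

lemma BV_minus:
  assumes "g \<in> BV"
  shows "(\<lambda>x. - g x) \<in> BV"
proof -
  have eq: "\<bar>- g x - - g y\<bar> = \<bar>g x - g y\<bar>" for x y by simp
  show ?thesis
    using assms unfolding BV_def bounded_variation_def eq mem_Collect_eq
    by (intro conjI tendsto_minus) blast+
qed

text \<open>Both the integral and the value
  \<open>F \<xi> * (g \<infinity> - g (-\<infinity>))\<close> change sign with \<open>g\<close>, so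
  the point found for \<open>- g\<close> also serves \<open>g\<close>.\<close>

lemma RS_mean_value:
  fixes F g :: "ereal \<Rightarrow> real"
  assumes F: "continuous_on UNIV F" and g: "mono g \<or> antimono g" and "g \<in> BV"
  shows "\<exists>\<xi>. has_RS_integral_ereal F g (F \<xi> * (g \<infinity> - g (-\<infinity>)))"
  using g
proof
  assume "antimono g"
  then have "mono (\<lambda>x. - g x)" by (auto simp: monotone_def)
  then obtain \<xi> where "has_RS_integral_ereal F (\<lambda>x. - g x) (F \<xi> * (- g \<infinity> - - g (-\<infinity>)))"
    using RS_mean_value_mono[OF F _ BV_minus[OF \<open>g \<in> BV\<close>]] by blast
  from has_RS_integral_ereal_minus[OF this]
  have "has_RS_integral_ereal F g (- (F \<xi> * (- g \<infinity> - - g (-\<infinity>))))" by simp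
  also have "- (F \<xi> * (- g \<infinity> - - g (-\<infinity>))) = F \<xi> * (g \<infinity> - g (-\<infinity>))"
    by (simp add: algebra_simps)
  finally show ?thesis by blast
qed (rule RS_mean_value_mono[OF F _ \<open>g \<in> BV\<close>])

section \<open>Integrators that agree on a dense set\<close>

definition dense_set :: "real set \<Rightarrow> bool" where
  "dense_set D \<longleftrightarrow> (\<forall>x y. x < y \<longrightarrow> (\<exists>d\<in>D. x < d \<and> d < y))"

lemma dense_setE:
  assumes "dense_set D" "x < y"
  obtains d where "d \<in> D" "x < d" "d < y"
  using assms(1)[unfolded dense_set_def, rule_format, OF assms(2)] by auto

lemma dense_set_co_countable:
  assumes "countable (- D)"
  shows "dense_set D"
  unfolding dense_set_def
proof (intro allI impI)
  fix x y :: real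
  assume "x < y"
  then have "\<not> {x<..<y} \<subseteq> - D"
    using assms countable_subset uncountable_open_interval by blast
  then show "\<exists>d\<in>D. x < d \<and> d < y" by auto
qed

text \<open>Walk from \<open>a\<close> to the right with steps of length between \<delta>/2 and
  \<delta>, landing in \<open>D\<close> each time. The upper bound keeps the cells fine; the lower
  bound makes the remaining length, measured in units of \<delta>/2, drop by at least one, which
  drives the induction on \<open>n\<close>.\<close>

lemma fine_tagged_division_exists_dense:
  fixes a b :: real
  assumes D: "dense_set D" and "\<delta> > 0" and "a \<in> D" "b \<in> D" "a < b"
  shows "\<exists>p. p tagged_division_of {a..b} \<and>
             (\<forall>(x, K)\<in>p. Sup K - Inf K < \<delta> \<and> Sup K \<in> D \<and> Inf K \<in> D)"
proof -
  have "\<exists>p. p tagged_division_of {a..b} \<and>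
            (\<forall>(x, K)\<in>p. Sup K - Inf K < \<delta> \<and> Sup K \<in> D \<and> Inf K \<in> D)"
    if "a \<in> D" "a < b" "b - a < real n * (\<delta> / 2)" for n a
    using that
  proof (induction n arbitrary: a)
    case (Suc n)
    show ?case
    proof (cases "b - a < \<delta>")
      case True
      then show ?thesis
        using Suc.prems \<open>b \<in> D\<close>
        by (intro exI[of _ "{(a, {a..b})}"]) (auto intro: tagged_division_of_self_real)
    next
      case False
      obtain c where c: "c \<in> D" "a + \<delta> / 2 < c" "c < a + \<delta>"
        using D by (rule dense_setE[of D "a + \<delta> / 2" "a + \<delta>"]) (use \<open>\<delta> > 0\<close> in auto)
      have "a < c" "c < b" using c False \<open>\<delta> > 0\<close> by auto
      have "b - c < real n * (\<delta> / 2)"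
        using Suc.prems(3) c(2) by (simp add: algebra_simps)
      then obtain p where p: "p tagged_division_of {c..b}"
        and fine: "\<forall>(x, K)\<in>p. Sup K - Inf K < \<delta> \<and> Sup K \<in> D \<and> Inf K \<in> D"
        using Suc.IH[of c] c \<open>c < b\<close> by blast
      have "({(a, {a..c})} \<union> p) tagged_division_of ({a..c} \<union> {c..b})"
        using \<open>a < c\<close> by (intro tagged_division_Un tagged_division_of_self_real p) auto
      moreover have "{a..c} \<union> {c..b} = {a..b}" using \<open>a < c\<close> \<open>c < b\<close> by auto
      ultimately show ?thesis
        using fine c Suc.prems(1) \<open>a < c\<close>
        by (intro exI[of _ "{(a, {a..c})} \<union> p"]) auto
    qed
  qed auto
  moreover obtain n where "(b - a) / (\<delta> / 2) < real n" using reals_Archimedean2 by blast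
  then have "b - a < real n * (\<delta> / 2)" using \<open>\<delta> > 0\<close> by (simp add: pos_divide_less_eq)
  ultimately show ?thesis using assms by blast
qed

text \<open>The triangle inequality in the form that ends the three uniqueness arguments
  below.\<close>

lemma abs_diff_half_contradiction:
  fixes x s s' :: real
  assumes "\<bar>x - s\<bar> < \<bar>s - s'\<bar> / 2" "\<bar>x - s'\<bar> < \<bar>s - s'\<bar> / 2"
  shows False
  using assms abs_triangle_ineq4[of "x - s'" "x - s"] by (simp add: field_simps)

lemma has_RS_integralE:
  assumes "has_RS_integral f g a b s" "\<epsilon> > 0"
  obtains \<delta> where "\<delta> > 0"
    "\<forall>p. p tagged_division_of {a..b} \<and> (\<forall>(x, K)\<in>p. Sup K - Inf K < \<delta>) \<longrightarrow>
      \<bar>(\<Sum>(x, K)\<in>p. f x * (g (Sup K) - g (Inf K))) - s\<bar> < \<epsilon>"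
  using assms(1)[unfolded has_RS_integral_def, THEN spec, THEN mp, OF assms(2)]
  by (elim exE conjE, intro that)

text \<open>A fine division with all cell endpoints in \<open>D\<close> has the same sum for
  \<open>g\<close> and \<open>g'\<close>, and this one sum approximates both integrals.\<close>

lemma has_RS_integral_unique_dense:
  assumes D: "dense_set D" "a \<in> D" "b \<in> D" "a < b"
    and s: "has_RS_integral f g a b s" and s': "has_RS_integral f g' a b s'"
    and eq: "\<And>x. x \<in> D \<Longrightarrow> g x = g' x"
  shows "s = s'"
proof (rule ccontr)
  assume "s \<noteq> s'"
  then have e: "\<bar>s - s'\<bar> / 2 > 0" by simp
  obtain \<delta> where "\<delta> > 0"
    and \<delta>: "\<forall>p. p tagged_division_of {a..b} \<and> (\<forall>(x, K)\<in>p. Sup K - Inf K < \<delta>) \<longrightarrow>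
      \<bar>(\<Sum>(x, K)\<in>p. f x * (g (Sup K) - g (Inf K))) - s\<bar> < \<bar>s - s'\<bar> / 2"
    using s e by (rule has_RS_integralE)
  obtain \<delta>' where "\<delta>' > 0"
    and \<delta>': "\<forall>p. p tagged_division_of {a..b} \<and> (\<forall>(x, K)\<in>p. Sup K - Inf K < \<delta>') \<longrightarrow>
      \<bar>(\<Sum>(x, K)\<in>p. f x * (g' (Sup K) - g' (Inf K))) - s'\<bar> < \<bar>s - s'\<bar> / 2"
    using s' e by (rule has_RS_integralE)
  obtain p where p: "p tagged_division_of {a..b}"
    and fine: "\<forall>(x, K)\<in>p. Sup K - Inf K < min \<delta> \<delta>' \<and> Sup K \<in> D \<and> Inf K \<in> D"
    using fine_tagged_division_exists_dense[OF D(1) _ D(2-4), of "min \<delta> \<delta>'"] \<open>\<delta> > 0\<close> \<open>\<delta>' > 0\<close>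
    by auto
  have "(\<Sum>(x, K)\<in>p. f x * (g (Sup K) - g (Inf K))) = (\<Sum>(x, K)\<in>p. f x * (g' (Sup K) - g' (Inf K)))"
    using fine by (intro sum.cong) (auto simp: eq)
  moreover have "\<forall>(x, K)\<in>p. Sup K - Inf K < \<delta>" "\<forall>(x, K)\<in>p. Sup K - Inf K < \<delta>'" using fine by auto
  ultimately show False
    using abs_diff_half_contradiction[OF \<delta>[THEN spec, THEN mp, OF conjI, OF p]]
      \<delta>'[THEN spec, THEN mp, OF conjI, OF p] by simp
qed

lemma has_RS_integral_ereal_unique_dense:
  assumes D: "dense_set D"
    and s: "has_RS_integral_ereal F g s" and s': "has_RS_integral_ereal F g' s'"
    and eq: "\<And>x. x \<in> D \<Longrightarrow> g (ereal x) = g' (ereal x)"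
  shows "s = s'"
proof (rule ccontr)
  assume "s \<noteq> s'"
  then have e: "\<bar>s - s'\<bar> / 2 > 0" by simp
  obtain J where J: "\<And>a b. a < b \<Longrightarrow> has_RS_integral (\<lambda>x. F (ereal x)) (\<lambda>x. g (ereal x)) a b (J a b)"
    and lim: "((\<lambda>(a, b). J a b) \<longlongrightarrow> s) (at_bot \<times>\<^sub>F at_top)"
    using s unfolding has_RS_integral_ereal_def by blast
  obtain J' where J': "\<And>a b. a < b \<Longrightarrow> has_RS_integral (\<lambda>x. F (ereal x)) (\<lambda>x. g' (ereal x)) a b (J' a b)"
    and lim': "((\<lambda>(a, b). J' a b) \<longlongrightarrow> s') (at_bot \<times>\<^sub>F at_top)"
    using s' unfolding has_RS_integral_ereal_def by blast
  have "\<forall>\<^sub>F (a, b) in at_bot \<times>\<^sub>F at_top. \<bar>J a b - s\<bar> < \<bar>s - s'\<bar> / 2 \<and> \<bar>J' a b - s'\<bar> < \<bar>s - s'\<bar> / 2"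
    using eventually_conj[OF tendstoD[OF lim e] tendstoD[OF lim' e]]
    by (simp add: case_prod_unfold dist_real_def)
  then obtain P Q where "eventually P at_bot" "eventually Q at_top"
    and PQ: "\<And>a b. P a \<Longrightarrow> Q b \<Longrightarrow> \<bar>J a b - s\<bar> < \<bar>s - s'\<bar> / 2 \<and> \<bar>J' a b - s'\<bar> < \<bar>s - s'\<bar> / 2"
    unfolding eventually_prod_filter by auto
  then obtain A B where A: "\<And>a. a \<le> A \<Longrightarrow> P a" and B: "\<And>b. b \<ge> B \<Longrightarrow> Q b"
    unfolding eventually_at_bot_linorder eventually_at_top_linorder by blast
  \<comment> \<open>Comparing with 0 as well gives \<open>a < 0 < b\<close>, so the interval is
    nondegenerate whatever \<open>A\<close> and \<open>B\<close> are.\<close>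
  obtain a where a: "a \<in> D" "min A 0 - 1 < a" "a < min A 0"
    using D by (rule dense_setE[of D "min A 0 - 1" "min A 0"]) auto
  obtain b where b: "b \<in> D" "max B 0 < b" "b < max B 0 + 1"
    using D by (rule dense_setE[of D "max B 0" "max B 0 + 1"]) auto
  have "a < b" using a b by linarith
  then have "J a b = J' a b"
    using \<open>a < b\<close> by (intro has_RS_integral_unique_dense[OF D a(1) b(1) _ J J'] eq)
  then show False
    using PQ[of a b] A[of a] B[of b] a b abs_diff_half_contradiction[of "J a b" s s'] by auto
qed

text \<open>Serves to compare the values at \<infinity> of two functions known to agree only off a
  countable set: \<open>D\<close> has points beyond every bound.\<close>

lemma tendsto_unique_dense:
  fixes f f' :: "real \<Rightarrow> real"
  assumes D: "dense_set D" and eq: "\<And>x. x \<in> D \<Longrightarrow> f x = f' x"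
    and l: "(f \<longlongrightarrow> l) at_top" and l': "(f' \<longlongrightarrow> l') at_top"
  shows "l = l'"
proof (rule ccontr)
  assume "l \<noteq> l'"
  then have e: "\<bar>l - l'\<bar> / 2 > 0" by simp
  have "\<forall>\<^sub>F x in at_top. \<bar>f x - l\<bar> < \<bar>l - l'\<bar> / 2 \<and> \<bar>f' x - l'\<bar> < \<bar>l - l'\<bar> / 2"
    using eventually_conj[OF tendstoD[OF l e] tendstoD[OF l' e]] by (simp add: dist_real_def)
  then obtain B where B: "\<And>x. x \<ge> B \<Longrightarrow> \<bar>f x - l\<bar> < \<bar>l - l'\<bar> / 2 \<and> \<bar>f' x - l'\<bar> < \<bar>l - l'\<bar> / 2"
    unfolding eventually_at_top_linorder by blast
  obtain b where "b \<in> D" "B < b" "b < B + 1"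
    using D by (rule dense_setE[of D B "B + 1"]) auto
  then show False
    using B[of b] eq[of b] abs_diff_half_contradiction[of "f b" l l'] by auto
qed

section \<open>Functions of bounded variation and iterated integrals\<close>

text \<open>The variation function of Jordan's decomposition, on [-\<infinity>, x]. Only the points
  \<open>c 0\<close> to \<open>c N\<close> count; by monotonicity \<open>c N \<le> x\<close> bounds
  all of them, while the rest of the sequence is free.\<close>

definition variation_upto :: "(ereal \<Rightarrow> real) \<Rightarrow> ereal \<Rightarrow> real" where
  "variation_upto g x =
     Sup {(\<Sum>i<N. \<bar>g (c (Suc i)) - g (c i)\<bar>) | c N. mono (c :: nat \<Rightarrow> ereal) \<and> c N \<le> x}"

text \<open>A chain that ends at or before \<open>x\<close> can be continued by \<open>x\<close> and
  then \<open>y\<close>, which adds at least \<open>\<bar>g y - g x\<bar>\<close> to its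
  sum.\<close>

lemma variation_upto_increment:
  assumes "bounded_variation g" "x \<le> y"
  shows "variation_upto g x + \<bar>g y - g x\<bar> \<le> variation_upto g y"
proof -
  define S where
    "S z = {(\<Sum>i<N. \<bar>g (c (Suc i)) - g (c i)\<bar>) | c N. mono (c :: nat \<Rightarrow> ereal) \<and> c N \<le> z}" for z
  obtain M where M: "\<And>(c :: nat \<Rightarrow> ereal) N. mono c \<Longrightarrow> (\<Sum>i<N. \<bar>g (c (Suc i)) - g (c i)\<bar>) \<le> M"
    using assms(1) unfolding bounded_variation_def by blast
  have bdd: "bdd_above (S z)" for z by (rule bdd_aboveI[of _ M]) (auto simp: S_def M)
  have "(\<Sum>i<0. \<bar>g x - g x\<bar>) \<in> S x"
    unfolding S_def by (rule CollectI, intro exI[of _ "\<lambda>_. x"] exI[of _ 0]) (auto simp: mono_def)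
  then have ne: "S x \<noteq> {}" by blast
  have "Sup (S x) \<le> Sup (S y) - \<bar>g y - g x\<bar>"
  proof (rule cSup_least[OF ne])
    fix s
    assume "s \<in> S x"
    then obtain c N where c: "mono c" "c N \<le> x" and s: "s = (\<Sum>i<N. \<bar>g (c (Suc i)) - g (c i)\<bar>)"
      unfolding S_def by blast
    \<comment> \<open>The increment from \<open>c N\<close> to \<open>x\<close> is nonnegative and
      is discarded in the estimate; the one from \<open>x\<close> to \<open>y\<close> is the
      gain.\<close>
    define c' where "c' i = (if i \<le> N then c i else if i = Suc N then x else y)" for i
    have "c i \<le> x" if "i \<le> N" for i using monoD[OF c(1) that] c(2) by (rule order_trans)
    then have "mono c'"
      using c \<open>x \<le> y\<close> unfolding c'_def
      by (intro monoI) (auto dest: monoD intro: order_trans)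
    then have "(\<Sum>i<Suc (Suc N). \<bar>g (c' (Suc i)) - g (c' i)\<bar>) \<in> S y"
      unfolding S_def by (rule_tac CollectI, intro exI[of _ c'] exI[of _ "Suc (Suc N)"]) (auto simp: c'_def)
    then have "(\<Sum>i<Suc (Suc N). \<bar>g (c' (Suc i)) - g (c' i)\<bar>) \<le> Sup (S y)"
      using bdd by (rule cSup_upper)
    moreover have "(\<Sum>i<N. \<bar>g (c' (Suc i)) - g (c' i)\<bar>) = s"
      unfolding s by (rule sum.cong) (auto simp: c'_def)
    ultimately show "s \<le> Sup (S y) - \<bar>g y - g x\<bar>"
      by (simp add: c'_def)
  qed
  then show ?thesis unfolding variation_upto_def S_def by simp
qed

text \<open>Jordan decomposition: \<open>u\<close> is the variation function and \<open>v\<close> is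
  \<open>u\<close> minus \<open>g\<close>. The increment inequality makes both monotone.\<close>

lemma bounded_variation_decompose:
  assumes "bounded_variation g"
  obtains u v :: "real \<Rightarrow> real" where "mono u" "mono v" "\<And>x. g (ereal x) = u x - v x"
proof
  note inc = variation_upto_increment[OF assms]
  show "mono (\<lambda>x. variation_upto g (ereal x))"
  proof (rule monoI)
    fix x y :: real
    assume "x \<le> y"
    then show "variation_upto g (ereal x) \<le> variation_upto g (ereal y)"
      using inc[of "ereal x" "ereal y"] by simp
  qed
  show "mono (\<lambda>x. variation_upto g (ereal x) - g (ereal x))"
  proof (rule monoI)
    fix x y :: real
    assume "x \<le> y"
    then show "variation_upto g (ereal x) - g (ereal x) \<le> variation_upto g (ereal y) - g (ereal y)"
      using inc[of "ereal x" "ereal y"] by simp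
  qed
qed simp

text \<open>A property shared by functions of bounded variation and their iterated integrals:
  integrals over bounded intervals exist, and differentiating them recovers the function off a
  countable set.\<close>

definition tame :: "(real \<Rightarrow> real) \<Rightarrow> bool" where
  "tame q \<longleftrightarrow> (\<forall>a b. set_integrable lborel {a..b} q) \<and> countable {x. \<not> isCont q x}"

lemma tame_mono:
  fixes u :: "real \<Rightarrow> real"
  assumes "mono u"
  shows "tame u"
  unfolding tame_def
proof (intro conjI allI)
  fix a b
  have [measurable]: "u \<in> borel_measurable borel" using assms by (rule borel_measurable_mono)
  have "\<bar>u x\<bar> \<le> max \<bar>u a\<bar> \<bar>u b\<bar>" if "x \<in> {a..b}" for x
    using that monoD[OF assms, of a x] monoD[OF assms, of x b] by auto
  then show "set_integrable lborel {a..b} u"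
    unfolding set_integrable_def
    by (intro integrableI_bounded_set_indicator[where B = "max \<bar>u a\<bar> \<bar>u b\<bar>"])
       (auto simp: emeasure_lborel_Icc_eq)
qed (rule mono_ctble_discont[OF assms])

lemma tame_diff:
  assumes "tame u" "tame v"
  shows "tame (\<lambda>x. u x - v x)"
proof -
  have "{x. \<not> isCont (\<lambda>x. u x - v x) x} \<subseteq> {x. \<not> isCont u x} \<union> {x. \<not> isCont v x}"
    by (auto intro: continuous_diff)
  then show ?thesis
    using assms unfolding tame_def by (auto intro: countable_subset set_integral_diff(1))
qed

lemma tame_continuous:
  assumes "continuous_on UNIV q"
  shows "tame q"
proof -
  have "isCont q x" for x using assms by (simp add: continuous_on_eq_continuous_at)
  moreover have "set_integrable lborel {a..b} q" for a b
    using borel_integrable_compact[of "{a..b}" q] continuous_on_subset[OF assms]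
    by (auto simp: set_integrable_def)
  ultimately show ?thesis by (simp add: tame_def)
qed

lemma tame_BV:
  assumes "g \<in> BV"
  shows "tame (\<lambda>x. g (ereal x))"
proof -
  obtain u v where "mono u" "mono v" "\<And>x. g (ereal x) = u x - v x"
    using bounded_variation_decompose[of g] assms unfolding BV_def by auto
  then show ?thesis by (simp add: tame_diff tame_mono)
qed

text \<open>Moves the base point from 0 to any \<open>a\<close> to the left of \<open>x\<close>, so
  that continuity and differentiation can be treated on an interval around \<open>x\<close> without
  regard to the sign of \<open>x\<close>.\<close>

lemma tame_interval_integral_split:
  assumes "tame q" "a \<le> x"
  shows "(LBINT t=ereal 0..ereal x. q t) = (LBINT t=ereal 0..ereal a. q t) + integral {a..x} q"
proof -
  have int: "interval_lebesgue_integrable lborel (ereal c) (ereal d) q" for c d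
  proof -
    have "set_integrable lborel {min c d..max c d} q" using assms(1) by (simp add: tame_def)
    then have "set_integrable lborel {min c d<..<max c d} q"
      by (rule set_integrable_subset) auto
    then show ?thesis
      by (auto simp: interval_lebesgue_integrable_def min_def max_def split: if_splits)
  qed
  have "interval_lebesgue_integrable lborel (min (ereal 0) (min (ereal a) (ereal x)))
          (max (ereal 0) (max (ereal a) (ereal x))) q"
    using int by (simp add: ereal_min[symmetric] ereal_max[symmetric] del: ereal_min ereal_max)
  then have "(LBINT t=ereal 0..ereal a. q t) + (LBINT t=ereal a..ereal x. q t) = (LBINT t=ereal 0..ereal x. q t)"
    by (rule interval_integral_sum)
  moreover have "(LBINT t=ereal a..ereal x. q t) = integral {a..x} q"
    using assms by (intro interval_integral_eq_integral) (auto simp: tame_def)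
  ultimately show ?thesis by simp
qed

lemma continuous_on_tame_integral:
  assumes "tame q"
  shows "continuous_on UNIV (\<lambda>x. LBINT t=ereal 0..ereal x. q t)"
proof -
  have "isCont (\<lambda>x. LBINT t=ereal 0..ereal x. q t) x" for x
  proof -
    have "q integrable_on {x - 1..x + 1}"
      using assms by (auto simp: tame_def intro: set_borel_integral_eq_integral)
    then have "continuous_on {x - 1..x + 1} (\<lambda>y. integral {x - 1..y} q)"
      by (rule indefinite_integral_continuous_1)
    then have "continuous_on {x - 1..x + 1}
        (\<lambda>y. (LBINT t=ereal 0..ereal (x - 1). q t) + integral {x - 1..y} q)"
      by (intro continuous_intros)
    then have "continuous_on {x - 1..x + 1} (\<lambda>x. LBINT t=ereal 0..ereal x. q t)"
      by (rule continuous_on_cong[THEN iffD1, rotated 2])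
         (auto simp: tame_interval_integral_split[OF assms])
    then show ?thesis
      by (rule continuous_on_interior) (auto simp: interior_atLeastAtMost_real)
  qed
  then show ?thesis by (simp add: continuous_on_eq_continuous_at)
qed

text \<open>At a common point of continuity both values are the derivative of the same indefinite
  integral.\<close>

lemma tame_integral_inject:
  assumes q: "tame q" and q': "tame q'"
    and eq: "\<And>x. (LBINT t=ereal 0..ereal x. q t) = (LBINT t=ereal 0..ereal x. q' t)"
    and cont: "isCont q x" "isCont q' x"
  shows "q x = q' x"
proof -
  have deriv: "((\<lambda>u. integral {x - 1..u} k) has_vector_derivative k x) (at x within {x - 1..x + 1})"
    if "tame k" "isCont k x" for k
    using that integral_has_vector_derivative_continuous_at[of k "x - 1" "x + 1" x "{}"]
    by (auto simp: tame_def continuous_at_imp_continuous_at_within intro: set_borel_integral_eq_integral)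
  have same: "integral {x - 1..u} q = integral {x - 1..u} q'" if "x - 1 \<le> u" for u
    using eq[of u] eq[of "x - 1"] tame_interval_integral_split[OF q that]
      tame_interval_integral_split[OF q' that] by linarith
  have "((\<lambda>u. integral {x - 1..u} q) has_vector_derivative q' x) (at x within {x - 1..x + 1})"
    by (rule has_vector_derivative_transform[OF _ _ deriv[OF q' cont(2)]]) (auto simp: same)
  with deriv[OF q cont(1)] show ?thesis
    by (simp add: at_within_Icc_at vector_derivative_unique_at)
qed

section \<open>Injectivity of the iterated integral up to countable sets\<close>

lemma tame_iter_int: "tame q \<Longrightarrow> tame (iter_int m q)"
  by (induction m) (simp_all add: tame_continuous continuous_on_tame_integral)

lemma continuous_on_iter_int:
  assumes "tame q" "m > 0"
  shows "continuous_on UNIV (iter_int m q)"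
  using assms by (cases m) (simp_all add: continuous_on_tame_integral tame_iter_int)

text \<open>Integrals are removed one at a time. As long as an integral remains inside, both
  integrands are continuous and agree everywhere; only the innermost step can lose points, namely
  the discontinuities of \<open>q\<close> and \<open>q'\<close>.\<close>

lemma iter_int_inject:
  assumes q: "tame q" and q': "tame q'" and "iter_int m q = iter_int m q'"
  shows "countable {x. q x \<noteq> q' x}"
  using assms(3)
proof (induction m)
  case (Suc m)
  have int: "(LBINT t=ereal 0..ereal y. iter_int m q t) = (LBINT t=ereal 0..ereal y. iter_int m q' t)" for y
    using fun_cong[OF Suc.prems, of y] by simp
  have eq: "iter_int m q x = iter_int m q' x"
    if "isCont (iter_int m q) x" "isCont (iter_int m q') x" for x
    using tame_integral_inject[OF tame_iter_int[OF q] tame_iter_int[OF q'] int that] .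
  show ?case
  proof (cases "m = 0")
    case True
    then have "{x. q x \<noteq> q' x} \<subseteq> {x. \<not> isCont q x} \<union> {x. \<not> isCont q' x}"
      using eq by auto
    moreover have "countable ({x. \<not> isCont q x} \<union> {x. \<not> isCont q' x})"
      using q q' by (simp add: tame_def)
    ultimately show ?thesis by (rule countable_subset)
  next
    case False
    then have "isCont (iter_int m q) x" "isCont (iter_int m q') x" for x
      using continuous_on_iter_int[OF q] continuous_on_iter_int[OF q']
      by (simp_all add: continuous_on_eq_continuous_at)
    then show ?thesis using eq by (intro Suc.IH) auto
  qed
qed simp

section \<open>Test functions and distributional derivatives\<close>

text \<open>Reads off all iterated derivatives from an explicit sequence of functions.\<close>

lemma funpow_deriv_eq:
  fixes u :: "nat \<Rightarrow> real \<Rightarrow> real"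
  assumes "\<And>k x. (u k has_real_derivative u (Suc k) x) (at x)"
  shows "(deriv ^^ k) (u 0) = u k"
proof (induction k)
  case (Suc k)
  then show ?case using assms by (auto intro: DERIV_imp_deriv)
qed simp

section \<open>Smooth functions and a smooth bump\<close>

definition smooth :: "(real \<Rightarrow> real) \<Rightarrow> bool" where
  "smooth f \<longleftrightarrow> (\<forall>k x. (deriv ^^ k) f differentiable (at x))"

text \<open>Avoids formulas for higher derivatives: it suffices to place \<open>f\<close> in some
  class closed under differentiation.\<close>

lemma smooth_coinduct:
  assumes "f \<in> S" and S: "\<And>f. f \<in> S \<Longrightarrow> \<exists>f'\<in>S. \<forall>x. (f has_real_derivative f' x) (at x)"
  shows "smooth f"
proof -
  have deriv: "deriv f \<in> S" "f differentiable (at x)" if fS: "f \<in> S" for f x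
  proof -
    obtain f' where f': "f' \<in> S" "\<And>x. (f has_real_derivative f' x) (at x)" using S[OF fS] by blast
    then have "deriv f = f'" by (auto intro: DERIV_imp_deriv)
    then show "deriv f \<in> S" using f' by simp
    show "f differentiable (at x)" unfolding real_differentiable_def using f' by blast
  qed
  have "(deriv ^^ k) f \<in> S" for k by (induction k) (simp_all add: assms(1) deriv)
  then show ?thesis unfolding smooth_def using deriv by blast
qed

lemma smooth_has_derivative:
  assumes "smooth f"
  shows "((deriv ^^ k) f has_real_derivative (deriv ^^ Suc k) f x) (at x)"
  using assms by (simp add: smooth_def DERIV_deriv_iff_real_differentiable)

lemma smooth_deriv: "smooth f \<Longrightarrow> smooth (deriv f)"
  unfolding smooth_def by (metis funpow_Suc_right comp_apply)

lemma continuous_on_smooth: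
  assumes "smooth f"
  shows "continuous_on A ((deriv ^^ k) f)"
  using smooth_has_derivative[OF assms] by (meson DERIV_continuous_on has_field_derivative_at_within)

lemma smooth_compose_affine:
  assumes "smooth f"
  shows "smooth (\<lambda>x. f (a * x + b))"
proof (rule smooth_coinduct)
  \<comment> \<open>The factor \<open>c\<close> is needed for closure, since the chain rule brings
    out a factor \<open>a\<close> at each differentiation.\<close>
  show "(\<lambda>x. f (a * x + b)) \<in> {\<lambda>x. c * f (a * x + b) | c f. smooth f}"
    using assms by (auto intro!: exI[of _ 1] exI[of _ f])
  fix h
  assume "h \<in> {\<lambda>x. c * f (a * x + b) | c f. smooth f}"
  then obtain c f where h: "h = (\<lambda>x. c * f (a * x + b))" and "smooth f" by blast
  have "(h has_real_derivative (c * a) * deriv f (a * x + b)) (at x)" for x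
  proof -
    have "(f has_real_derivative deriv f (a * x + b)) (at (a * x + b))"
      using smooth_has_derivative[OF \<open>smooth f\<close>, of 0] by simp
    moreover have "((\<lambda>x. a * x + b) has_real_derivative a) (at x)"
      by (auto intro!: derivative_eq_intros)
    ultimately have "((\<lambda>x. f (a * x + b)) has_real_derivative deriv f (a * x + b) * a) (at x)"
      by (rule DERIV_chain2)
    then show ?thesis unfolding h by (auto dest: DERIV_cmult[of _ _ _ _ c] simp: mult_ac)
  qed
  then show "\<exists>h'\<in>{\<lambda>x. c * f (a * x + b) | c f. smooth f}. \<forall>x. (h has_real_derivative h' x) (at x)"
    using smooth_deriv[OF \<open>smooth f\<close>]
    by (intro bexI[of _ "\<lambda>x. (c * a) * deriv f (a * x + b)"]) auto
qed

text \<open>A class that contains \<open>f g\<close> and is closed under differentiation, as needed for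
  \<open>smooth_coinduct\<close>.\<close>

inductive_set product_sums :: "(real \<Rightarrow> real) set" where
  mult: "smooth f \<Longrightarrow> smooth g \<Longrightarrow> (\<lambda>x. f x * g x) \<in> product_sums"
| add: "f \<in> product_sums \<Longrightarrow> g \<in> product_sums \<Longrightarrow> (\<lambda>x. f x + g x) \<in> product_sums"

lemma smooth_mult:
  assumes "smooth f" "smooth g"
  shows "smooth (\<lambda>x. f x * g x)"
proof (rule smooth_coinduct)
  show "(\<lambda>x. f x * g x) \<in> product_sums" using assms by (rule product_sums.mult)
  fix h
  assume "h \<in> product_sums"
  then show "\<exists>h'\<in>product_sums. \<forall>x. (h has_real_derivative h' x) (at x)"
  proof induction
    case (mult f g)
    have "((\<lambda>x. f x * g x) has_real_derivative (deriv f x * g x + f x * deriv g x)) (at x)" for x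
      using smooth_has_derivative[OF mult(1), of 0 x] smooth_has_derivative[OF mult(2), of 0 x]
      by (auto intro!: derivative_eq_intros)
    moreover have "(\<lambda>x. deriv f x * g x + f x * deriv g x) \<in> product_sums"
      using mult by (intro product_sums.intros smooth_deriv)
    ultimately show ?case by (intro bexI[of _ "\<lambda>x. deriv f x * g x + f x * deriv g x"] allI)
  next
    case (add f g)
    then obtain f' g' where fg: "f' \<in> product_sums" "g' \<in> product_sums"
      "\<And>x. (f has_real_derivative f' x) (at x)" "\<And>x. (g has_real_derivative g' x) (at x)" by blast
    then have "((\<lambda>x. f x + g x) has_real_derivative (f' x + g' x)) (at x)" for x
      by (intro DERIV_add)
    then show ?case
      using product_sums.add[OF fg(1,2)] by (intro bexI[of _ "\<lambda>x. f' x + g' x"] allI)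
  qed
qed

text \<open>For \<open>P = 1\<close> this is the classical smooth function that is flat at 0.
  Admitting polynomials in 1/x as factors makes the class closed under differentiation.\<close>

definition recip_exp :: "real poly \<Rightarrow> real \<Rightarrow> real" where
  "recip_exp P x = (if x > 0 then poly P (1 / x) * exp (- (1 / x)) else 0)"

text \<open>The power \<open>t ^ k\<close> is there for the induction: splitting off the constant
  coefficient of \<open>P\<close> raises \<open>k\<close> by one.\<close>

lemma poly_times_exp_minus_tendsto_0:
  fixes P :: "real poly"
  shows "((\<lambda>t. t ^ k * poly P t * exp (- t)) \<longlongrightarrow> 0) at_top"
proof (induction P arbitrary: k)
  case (pCons a P)
  have "((\<lambda>t. a * (t ^ k / exp t) + t ^ Suc k * poly P t * exp (- t)) \<longlongrightarrow> a * 0 + 0) at_top"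
    by (intro tendsto_intros tendsto_power_div_exp_0 pCons.IH)
  then show ?case by (simp add: algebra_simps exp_minus divide_inverse)
qed simp

text \<open>With t = 1/x the chain rule yields the factor t^2, which is the polynomial
  \<open>[:0, 0, 1:]\<close>, and the product rule yields \<open>P - pderiv P\<close>. At 0 the
  difference quotient from the right becomes t P(t) exp(-t) with t tending to infinity, and so tends
  to 0.\<close>

lemma recip_exp_has_derivative:
  "(recip_exp P has_real_derivative recip_exp ([:0, 0, 1:] * (P - pderiv P)) x) (at x)"
proof (cases x "0 :: real" rule: linorder_cases)
  case less
  have "((\<lambda>_. 0) has_real_derivative 0) (at x)" by simp
  then have "(recip_exp P has_real_derivative 0) (at x)"
    by (rule has_field_derivative_transform_within_open[of _ _ _ "{..<0}"]) (use less in \<open>auto simp: recip_exp_def\<close>)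
  then show ?thesis using less by (simp add: recip_exp_def)
next
  case greater
  have "((\<lambda>x. poly P (1 / x) * exp (- (1 / x))) has_real_derivative
      (1 / x) * (1 / x) * (poly P (1 / x) - poly (pderiv P) (1 / x)) * exp (- (1 / x))) (at x)"
  proof -
    have inv: "((\<lambda>x. 1 / x) has_real_derivative - (1 / x * (1 / x))) (at x)"
      using greater by (auto intro!: derivative_eq_intros)
    show ?thesis
      by (rule DERIV_cong[OF DERIV_mult[OF DERIV_chain2[OF poly_DERIV inv]
            DERIV_chain2[OF DERIV_exp DERIV_minus[OF inv]]]])
         (simp add: algebra_simps)
  qed
  then have "(recip_exp P has_real_derivative
      (1 / x) * (1 / x) * (poly P (1 / x) - poly (pderiv P) (1 / x)) * exp (- (1 / x))) (at x)"
    by (rule has_field_derivative_transform_within_open[of _ _ _ "{0<..}"])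
       (use greater in \<open>auto simp: recip_exp_def\<close>)
  then show ?thesis using greater by (simp add: recip_exp_def algebra_simps)
next
  case equal
  have "((\<lambda>h. recip_exp P h / h) \<longlongrightarrow> 0) (at 0)"
  proof (rule filterlim_split_at)
    show "((\<lambda>h. recip_exp P h / h) \<longlongrightarrow> 0) (at_left 0)"
      by (rule tendsto_eventually) (auto simp: eventually_at_filter recip_exp_def)
    have "\<forall>\<^sub>F t in at_top. t ^ 1 * poly P t * exp (- t) = recip_exp P (inverse t) / inverse t"
      using eventually_gt_at_top[of 0] by eventually_elim (simp add: recip_exp_def divide_inverse)
    then have "((\<lambda>t. recip_exp P (inverse t) / inverse t) \<longlongrightarrow> 0) at_top"
      by (rule Lim_transform_eventually[OF poly_times_exp_minus_tendsto_0])
    then show "((\<lambda>h. recip_exp P h / h) \<longlongrightarrow> 0) (at_right 0)"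
      by (simp add: filterlim_at_right_to_top)
  qed
  then show ?thesis using equal by (simp add: DERIV_def recip_exp_def)
qed

lemma smooth_recip_exp: "smooth (recip_exp P)"
  by (rule smooth_coinduct[of _ "range recip_exp"]) (use recip_exp_has_derivative in blast)+

definition bump :: "real \<Rightarrow> real" where
  "bump x = recip_exp 1 x * recip_exp 1 (1 - x)"

lemma smooth_bump: "smooth bump"
proof -
  have "smooth (\<lambda>x. recip_exp 1 x * recip_exp 1 ((-1) * x + 1))"
    by (intro smooth_mult smooth_compose_affine smooth_recip_exp)
  then show ?thesis by (simp add: bump_def[abs_def])
qed

lemma bump_nonneg: "bump x \<ge> 0"
  and bump_pos_iff: "bump x > 0 \<longleftrightarrow> 0 < x \<and> x < 1"
  by (auto simp: bump_def recip_exp_def)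

section \<open>Test functions and their pairing with continuous functions\<close>

lemma test_functionsI:
  assumes "smooth \<phi>" "\<And>x. R < \<bar>x\<bar> \<Longrightarrow> \<phi> x = 0"
  shows "\<phi> \<in> test_functions"
proof -
  have "{x. \<phi> x \<noteq> 0} \<subseteq> {-R..R}" using assms(2) by (force simp: not_less[symmetric])
  then have "bounded {x. \<phi> x \<noteq> 0}" using bounded_closed_interval bounded_subset by blast
  then show ?thesis using assms(1) by (simp add: test_functions_def smooth_def compact_closure)
qed

text \<open>One radius serves all derivatives, because a function that vanishes on the open set R <
  |x| has derivative zero there.\<close>

lemma test_functionsE:
  assumes "\<phi> \<in> test_functions"
  obtains R where "smooth \<phi>" "R > 0" "\<forall>k x. R < \<bar>x\<bar> \<longrightarrow> (deriv ^^ k) \<phi> x = 0"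
proof -
  have s: "smooth \<phi>" using assms by (simp add: test_functions_def smooth_def)
  have "bounded {x. \<phi> x \<noteq> 0}" using assms by (simp add: test_functions_def compact_closure)
  then obtain R where "R > 0" and R: "\<And>x. \<phi> x \<noteq> 0 \<Longrightarrow> \<bar>x\<bar> \<le> R"
    unfolding bounded_pos by auto
  have "R < \<bar>x\<bar> \<Longrightarrow> (deriv ^^ k) \<phi> x = 0" for k x
  proof (induction k arbitrary: x)
    case (Suc k)
    have "((deriv ^^ k) \<phi> has_real_derivative 0) (at x)"
    proof (rule has_field_derivative_transform_within_open)
      show "((\<lambda>_. 0) has_real_derivative 0) (at x)" by simp
      show "open {x. R < \<bar>x\<bar>}" by (intro open_Collect_less continuous_intros)
      show "x \<in> {x. R < \<bar>x\<bar>}" using Suc.prems by simp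
      show "0 = (deriv ^^ k) \<phi> y" if "y \<in> {x. R < \<bar>x\<bar>}" for y
        using Suc.IH[of y] that by simp
    qed
    then show ?case by (simp add: DERIV_imp_deriv)
  qed (use R in force)
  then show ?thesis using that[OF s \<open>R > 0\<close>] by simp
qed

lemma deriv_test_function:
  assumes "\<phi> \<in> test_functions"
  shows "deriv \<phi> \<in> test_functions"
proof -
  from assms obtain R where "smooth \<phi>" "R > 0" and R: "\<forall>k x. R < \<bar>x\<bar> \<longrightarrow> (deriv ^^ k) \<phi> x = 0"
    by (rule test_functionsE)
  then show ?thesis using R[rule_format, of _ 1] by (intro test_functionsI[of _ R] smooth_deriv) auto
qed

lemma nth_deriv_apply:
  assumes "\<phi> \<in> test_functions"
  shows "nth_deriv n F \<phi> = (-1) ^ n * (LINT x|lborel. F (ereal x) * (deriv ^^ n) \<phi> x)"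
  using assms
proof (induction n arbitrary: \<phi>)
  case 0
  then show ?case by (simp add: nth_deriv_def distr_of_def)
next
  case (Suc n)
  have "nth_deriv (Suc n) F \<phi> = - nth_deriv n F (deriv \<phi>)"
    using Suc.prems by (simp add: nth_deriv_def distr_deriv_def)
  then show ?case
    using Suc.IH[OF deriv_test_function[OF Suc.prems]] by (simp add: funpow_swap1)
qed

lemma integrable_mult_test_function:
  assumes D: "continuous_on UNIV D" and "\<phi> \<in> test_functions"
  shows "integrable lborel (\<lambda>x. D (x + c) * (deriv ^^ k) \<phi> x)"
proof -
  from assms(2) obtain R where s: "smooth \<phi>" and "R > 0"
    and R: "\<forall>k x. R < \<bar>x\<bar> \<longrightarrow> (deriv ^^ k) \<phi> x = 0"
    by (rule test_functionsE)
  have "continuous_on {-R..R} (\<lambda>x. D (x + c))"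
    by (rule continuous_on_compose2[OF D]) (auto intro!: continuous_intros)
  then have "integrable lborel (\<lambda>x. indicator {-R..R} x *\<^sub>R (D (x + c) * (deriv ^^ k) \<phi> x))"
    by (intro borel_integrable_compact continuous_on_mult continuous_on_smooth s) auto
  moreover have eq: "indicator {-R..R} x *\<^sub>R (D (x + c) * (deriv ^^ k) \<phi> x) = D (x + c) * (deriv ^^ k) \<phi> x" for x
  proof -
    have "x \<in> {-R..R} \<or> R < \<bar>x\<bar>" by auto
    then show ?thesis using R[rule_format, of x k] by auto
  qed
  ultimately show ?thesis unfolding eq by simp
qed

text \<open>The antiderivative is in general no test function, as \<open>c\<close> is the total
  integral of \<open>\<phi>\<close>; it is constant on each side of the support, which is enough for
  differences of translates.\<close>

lemma test_function_antiderivative: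
  assumes "\<phi> \<in> test_functions"
  obtains P c R where "\<And>x. (P has_real_derivative \<phi> x) (at x)"
    "\<And>x. x < -R \<Longrightarrow> P x = 0" "\<And>x. x > R \<Longrightarrow> P x = c" "R > 0"
proof -
  from assms obtain R where s: "smooth \<phi>" and "R > 0"
    and R0: "\<forall>k x. R < \<bar>x\<bar> \<longrightarrow> (deriv ^^ k) \<phi> x = 0"
    by (rule test_functionsE)
  have R: "\<phi> x = 0" if "R < \<bar>x\<bar>" for x using R0[rule_format, of x 0] that by simp
  \<comment> \<open>The base point lies strictly to the left of \<open>-R\<close>, so that each
    \<open>x \<ge> -R\<close> is interior to \<open>{-R - 1..x + 1}\<close> and the derivative there
    is two-sided.\<close>
  define P where "P x = integral {-R - 1..x} \<phi>" for x
  have cont: "continuous_on A \<phi>" for A using continuous_on_smooth[OF s, of _ 0] by simp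
  have int: "\<phi> integrable_on {a..b}" for a b by (rule integrable_continuous_interval[OF cont])
  have zero: "integral {a..b} \<phi> = 0" if "b < -R \<or> R < a" for a b
  proof -
    have "integral {a..b} \<phi> = integral {a..b} (\<lambda>_. 0)"
      using that \<open>R > 0\<close> by (intro integral_cong R) auto
    then show ?thesis by simp
  qed
  have left: "P x = 0" if "x < -R" for x using zero[of x] that by (simp add: P_def)
  have right: "P x = P (R + 1)" if "x > R" for x
  proof -
    have "P a + integral {a..b} \<phi> = P b" if "R < a" "a \<le> b" for a b
      unfolding P_def using that \<open>R > 0\<close>
      by (intro Henstock_Kurzweil_Integration.integral_combine int) auto
    from this[of x "R + 1"] this[of "R + 1" x] show ?thesis
      using that zero[of "R + 1" x] zero[of x "R + 1"] by linarith
  qed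
  have "(P has_real_derivative \<phi> x) (at x)" for x
  proof (cases "x < -R")
    case True
    have "(P has_real_derivative 0) (at x)"
    proof (rule has_field_derivative_transform_within_open)
      show "((\<lambda>_. 0) has_real_derivative 0) (at x)" by simp
      show "open {..<-R}" by simp
      show "x \<in> {..<-R}" using True by simp
      show "0 = P y" if "y \<in> {..<-R}" for y using left[of y] that by simp
    qed
    then show ?thesis using R[of x] True \<open>R > 0\<close> by simp
  next
    case False
    then have x: "-R - 1 < x" "x < x + 1" by auto
    have "(P has_real_derivative \<phi> x) (at x within {-R - 1..x + 1})"
      unfolding P_def using x by (intro integral_has_real_derivative cont) auto
    then show ?thesis by (simp add: at_within_Icc_at[OF x])
  qed
  from this left right \<open>R > 0\<close> show ?thesis by (rule that)
qed

text \<open>Take \<Phi>(x) = P(x) - P(x + h) for an antiderivative P of \<open>\<phi>\<close>: the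
  constant values of P on either side of the support cancel, so \<Phi> vanishes for |x| > R +
  |h|.\<close>

lemma test_function_translate_diff:
  assumes "\<phi> \<in> test_functions"
  obtains \<Phi> where "\<Phi> \<in> test_functions"
    "\<And>k x. (deriv ^^ Suc k) \<Phi> x = (deriv ^^ k) \<phi> x - (deriv ^^ k) \<phi> (x + h)"
proof -
  obtain P c R where P: "\<And>x. (P has_real_derivative \<phi> x) (at x)"
    and left: "\<And>x. x < -R \<Longrightarrow> P x = 0" and right: "\<And>x. x > R \<Longrightarrow> P x = c" and "R > 0"
    using test_function_antiderivative[OF assms] by metis
  have s: "smooth \<phi>" using assms by (simp add: test_functions_def smooth_def)
  \<comment> \<open>The sequence of derivatives of \<Phi>, starting with \<Phi> itself.\<close>
  define u where "u k = (case k of 0 \<Rightarrow> \<lambda>x. P x - P (x + h)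
      | Suc k \<Rightarrow> \<lambda>x. (deriv ^^ k) \<phi> x - (deriv ^^ k) \<phi> (x + h))" for k
  have shift: "((\<lambda>x. f x - f (x + h)) has_real_derivative f' x - f' (x + h)) (at x)"
    if "\<And>x. (f has_real_derivative f' x) (at x)" for f f' x
    using that[of x] that[of "x + h"] by (intro DERIV_diff) (simp_all add: DERIV_shift)
  have u: "(u k has_real_derivative u (Suc k) x) (at x)" for k x
  proof (cases k)
    case 0
    then show ?thesis using shift[OF P] by (simp add: u_def)
  next
    case (Suc j)
    then show ?thesis using shift[OF smooth_has_derivative[OF s, of j]] by (simp add: u_def)
  qed
  note iter = funpow_deriv_eq[of u, OF u]
  have "smooth (u 0)"
    unfolding smooth_def iter real_differentiable_def using u by blast
  moreover have "u 0 x = 0" if "R + \<bar>h\<bar> < \<bar>x\<bar>" for x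
  proof (cases "x < 0")
    case True
    then show ?thesis using that left[of x] left[of "x + h"] by (simp add: u_def)
  next
    case False
    then show ?thesis using that right[of x] right[of "x + h"] by (simp add: u_def)
  qed
  ultimately have "u 0 \<in> test_functions" by (rule test_functionsI)
  then show ?thesis
  proof (rule that)
    show "(deriv ^^ Suc k) (u 0) x = (deriv ^^ k) \<phi> x - (deriv ^^ k) \<phi> (x + h)" for k x
      unfolding iter by (simp add: u_def)
  qed
qed

text \<open>The test function \<open>\<phi> - \<phi>(\<cdot> + h)\<close> is a derivative, so the pairing of \<open>D\<close> with \<open>\<phi>\<^sup>(\<^sup>m\<^sup>)\<close> does
  not change when \<open>D\<close> is translated; translating \<open>D\<close> towards \<open>-\<infinity>\<close> makes it vanish.\<close>

lemma vanishing_moment_step: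
  assumes D: "continuous_on UNIV D" and B: "\<And>x. \<bar>D x\<bar> \<le> B" and lim: "(D \<longlongrightarrow> 0) at_bot"
    and vanish: "\<And>\<phi>. \<phi> \<in> test_functions \<Longrightarrow> (LINT x|lborel. D x * (deriv ^^ Suc m) \<phi> x) = 0"
    and \<phi>: "\<phi> \<in> test_functions"
  shows "(LINT x|lborel. D x * (deriv ^^ m) \<phi> x) = 0"
proof -
  define \<psi> where "\<psi> = (deriv ^^ m) \<phi>"
  have int: "integrable lborel (\<lambda>x. D (x + c) * \<psi> x)" for c
    unfolding \<psi>_def by (rule integrable_mult_test_function[OF D \<phi>])
  have trans: "(LINT x|lborel. D x * \<psi> x) = (LINT x|lborel. D (x + - h) * \<psi> x)" for h
  proof -
    obtain \<Phi> where \<Phi>: "\<Phi> \<in> test_functions"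
      "\<And>x. (deriv ^^ Suc m) \<Phi> x = \<psi> x - \<psi> (x + h)"
      unfolding \<psi>_def using test_function_translate_diff[OF \<phi>, of h] by metis
    \<comment> \<open>Substituting x + h for x moves the translation from \<open>\<psi>\<close> to
      \<open>D\<close>.\<close>
    have int': "integrable lborel (\<lambda>x. D x * \<psi> (x + h))"
      using lborel_integrable_real_affine[OF int[of "-h"], of 1 h] by (simp add: add.commute)
    have "0 = (LINT x|lborel. D x * \<psi> x - D x * \<psi> (x + h))"
      using vanish[OF \<Phi>(1)] unfolding \<Phi>(2) by (simp add: right_diff_distrib)
    also have "\<dots> = (LINT x|lborel. D x * \<psi> x) - (LINT x|lborel. D x * \<psi> (x + h))"
      using int[of 0] int' by simp
    also have "(LINT x|lborel. D x * \<psi> (x + h)) = (LINT x|lborel. D (x + - h) * \<psi> x)"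
      using lborel_integral_real_affine[of 1 "\<lambda>x. D (x + - h) * \<psi> x" h] by (simp add: add.commute)
    finally show ?thesis by simp
  qed
  \<comment> \<open>By \<open>trans\<close> this sequence is constant, so its limit is the integral
    in question; the bound \<open>B\<close> supplies the dominating function.\<close>
  have "(\<lambda>i. LINT x|lborel. D (x + - real i) * \<psi> x) \<longlonglongrightarrow> (LINT x|(lborel :: real measure). (0 :: real))"
  proof (rule integral_dominated_convergence)
    show "integrable lborel (\<lambda>x. B * \<bar>\<psi> x\<bar>)"
      using integrable_mult_test_function[of "\<lambda>_. 1" \<phi> 0 m] \<phi> unfolding \<psi>_def by auto
    have "((\<lambda>i. D (x + - real i)) \<longlonglongrightarrow> 0)" for x
    proof (rule filterlim_compose[OF lim])
      show "LIM i sequentially. x + - real i :> at_bot"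
        unfolding filterlim_at_bot
      proof
        fix Z
        show "\<forall>\<^sub>F i in sequentially. x + - real i \<le> Z"
          using eventually_ge_at_top[of "nat \<lceil>x - Z\<rceil>"] by eventually_elim linarith
      qed
    qed
    then show "AE x in lborel. (\<lambda>i. D (x + - real i) * \<psi> x) \<longlonglongrightarrow> 0"
      by (intro AE_I2 tendsto_mult_left_zero)
    show "AE x in lborel. norm (D (x + - real i) * \<psi> x) \<le> B * \<bar>\<psi> x\<bar>" for i
      using B by (intro AE_I2) (simp add: abs_mult mult_right_mono)
  qed (use int borel_measurable_integrable in blast)+
  then have "(\<lambda>i :: nat. LINT x|lborel. D x * \<psi> x) \<longlonglongrightarrow> 0"
    unfolding trans[symmetric] by simp
  then show ?thesis by (simp add: \<psi>_def LIMSEQ_const_iff)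
qed

text \<open>If \<open>D a\<close> were positive, \<open>D\<close> would be positive on some (a, a +
  \<delta>), and a bump living exactly there would have a positive integral against
  \<open>D\<close>.\<close>

lemma nonpos_of_vanishing_integrals:
  assumes D: "continuous_on UNIV D"
    and vanish: "\<And>\<phi>. \<phi> \<in> test_functions \<Longrightarrow> (LINT x|lborel. D x * \<phi> x) = 0"
  shows "D a \<le> 0"
proof (rule ccontr)
  assume "\<not> D a \<le> 0"
  then have "D a > 0" by simp
  moreover have "isCont D a" using D by (simp add: continuous_on_eq_continuous_at)
  ultimately have "\<forall>\<^sub>F x in nhds a. D x > 0"
    by (metis isCont_def tendsto_at_iff_tendsto_nhds order_tendstoD(1))
  then obtain \<delta> where "\<delta> > 0" and \<delta>: "\<And>x. \<bar>x - a\<bar> < \<delta> \<Longrightarrow> D x > 0"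
    unfolding eventually_nhds_metric dist_real_def by auto
  \<comment> \<open>The affine map takes (a, a + \<delta>) onto (0, 1), where \<open>bump\<close> is
    positive.\<close>
  define \<phi> where "\<phi> x = bump ((1 / \<delta>) * x + - a / \<delta>)" for x
  have arg: "(1 / \<delta>) * x + - a / \<delta> = (x - a) / \<delta>" for x by (simp add: diff_divide_distrib)
  have pos: "\<phi> x > 0 \<longleftrightarrow> x \<in> {a<..<a + \<delta>}" for x
    unfolding \<phi>_def arg bump_pos_iff using \<open>\<delta> > 0\<close> by (auto simp: field_simps)
  have nonneg: "\<phi> x \<ge> 0" for x by (simp add: \<phi>_def bump_nonneg)
  have test: "\<phi> \<in> test_functions"
  proof (rule test_functionsI)
    show "smooth \<phi>" unfolding \<phi>_def by (rule smooth_compose_affine[OF smooth_bump])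
    show "\<phi> x = 0" if "\<bar>a\<bar> + \<delta> < \<bar>x\<bar>" for x
      using that pos[of x] nonneg[of x] by auto
  qed
  have "D x * \<phi> x \<ge> 0" for x
    using \<delta>[of x] pos[of x] nonneg[of x] by (cases "\<phi> x = 0") auto
  moreover have "integrable lborel (\<lambda>x. D x * \<phi> x)"
    using integrable_mult_test_function[OF D test, of 0 0] by simp
  ultimately have "AE x in lborel. D x * \<phi> x = 0"
    using vanish[OF test] integral_nonneg_eq_0_iff_AE[of lborel "\<lambda>x. D x * \<phi> x"] by simp
  then have "AE x in lborel. x \<notin> {a<..<a + \<delta>}"
  proof eventually_elim
    case (elim x)
    then show ?case using \<delta>[of x] pos[of x] by auto
  qed
  then have "{a<..<a + \<delta>} \<in> null_sets lborel" by (subst AE_iff_null_sets) auto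
  then have "emeasure lborel {a<..<a + \<delta>} = 0" by (simp add: null_sets_def)
  then show False using \<open>\<delta> > 0\<close> by simp
qed

lemma zero_of_vanishing_integrals:
  assumes D: "continuous_on UNIV D"
    and vanish: "\<And>\<phi>. \<phi> \<in> test_functions \<Longrightarrow> (LINT x|lborel. D x * \<phi> x) = 0"
  shows "D a = 0"
proof (rule antisym)
  show "D a \<le> 0" using assms by (rule nonpos_of_vanishing_integrals)
  have "- D a \<le> 0"
    by (rule nonpos_of_vanishing_integrals[of "\<lambda>x. - D x"])
       (use D vanish in \<open>auto intro: continuous_on_minus\<close>)
  then show "0 \<le> D a" by simp
qed

section \<open>The mean value theorem\<close>

lemma Bc_real:
  assumes "F \<in> Bc"
  shows "continuous_on UNIV (\<lambda>x. F (ereal x))" "((\<lambda>x. F (ereal x)) \<longlongrightarrow> F \<infinity>) at_top"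
    "((\<lambda>x. F (ereal x)) \<longlongrightarrow> 0) at_bot"
proof -
  have F: "continuous_on UNIV F" "F (-\<infinity>) = 0" using assms by (auto simp: Bc_def)
  then have at: "(F \<longlongrightarrow> F x) (nhds x)" for x
    by (simp add: continuous_on_eq_continuous_at isCont_def tendsto_at_iff_tendsto_nhds)
  show "continuous_on UNIV (\<lambda>x. F (ereal x))"
    using continuous_on_compose2[OF F(1) continuous_on_ereal[OF continuous_on_id]] by auto
  have "(ereal \<longlongrightarrow> \<infinity>) at_top"
    by (auto simp: tendsto_PInfty eventually_gt_at_top)
  from filterlim_compose[OF at this] show "((\<lambda>x. F (ereal x)) \<longlongrightarrow> F \<infinity>) at_top" .
  have "(ereal \<longlongrightarrow> -\<infinity>) at_bot"
    by (auto simp: tendsto_MInfty eventually_gt_at_bot)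
  from filterlim_compose[OF at this] show "((\<lambda>x. F (ereal x)) \<longlongrightarrow> 0) at_bot"
    by (simp add: F(2))
qed

text \<open>Vanishing of an n-th distributional derivative leaves room for polynomials of degree
  below n; boundedness of \<open>D\<close> and its limit 0 at -\<infinity> exclude all but zero.
  \<open>vanishing_moment_step\<close> uses exactly these two facts to strip off one derivative at a
  time.\<close>

lemma nth_deriv_inject:
  assumes F: "F \<in> Bc" and G: "G \<in> Bc" and eq: "nth_deriv n F = nth_deriv n G"
  shows "F = G"
proof -
  define D where "D x = F (ereal x) - G (ereal x)" for x
  have D: "continuous_on UNIV D"
    unfolding D_def using Bc_real(1)[OF F] Bc_real(1)[OF G] by (intro continuous_on_diff)
  have lim: "(D \<longlongrightarrow> 0) at_bot"
    unfolding D_def using tendsto_diff[OF Bc_real(3)[OF F] Bc_real(3)[OF G]] by simp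
  obtain A where A: "\<And>x. \<bar>F x\<bar> \<le> A" using bounded_continuous_ereal[of F] F by (auto simp: Bc_def)
  obtain B where B: "\<And>x. \<bar>G x\<bar> \<le> B" using bounded_continuous_ereal[of G] G by (auto simp: Bc_def)
  have bd: "\<bar>D x\<bar> \<le> A + B" for x
    unfolding D_def using A[of "ereal x"] B[of "ereal x"] by linarith
  have base: "(LINT x|lborel. D x * (deriv ^^ n) \<phi> x) = 0" if "\<phi> \<in> test_functions" for \<phi>
  proof -
    have "(LINT x|lborel. D x * (deriv ^^ n) \<phi> x) =
        (LINT x|lborel. F (ereal x) * (deriv ^^ n) \<phi> x) - (LINT x|lborel. G (ereal x) * (deriv ^^ n) \<phi> x)"
      unfolding D_def left_diff_distrib
      using integrable_mult_test_function[OF Bc_real(1)[OF F] that, of 0 n]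
        integrable_mult_test_function[OF Bc_real(1)[OF G] that, of 0 n]
      by simp
    then show ?thesis
      using fun_cong[OF eq, of \<phi>] by (simp add: nth_deriv_apply[OF that])
  qed
  \<comment> \<open>\<open>k\<close> counts the derivatives already removed; at \<open>k = n\<close>
    the pairing is with \<open>\<phi>\<close> itself.\<close>
  have "k \<le> n \<Longrightarrow> \<forall>\<phi>\<in>test_functions. (LINT x|lborel. D x * (deriv ^^ (n - k)) \<phi> x) = 0" for k
  proof (induction k)
    case (Suc k)
    then have "Suc (n - Suc k) = n - k" by simp
    with Suc have "\<And>\<phi>. \<phi> \<in> test_functions \<Longrightarrow>
        (LINT x|lborel. D x * (deriv ^^ Suc (n - Suc k)) \<phi> x) = 0" by simp
    then show ?case by (blast intro: vanishing_moment_step[OF D bd lim])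
  qed (simp add: base)
  from this[of n] have "D x = 0" for x
    by (intro zero_of_vanishing_integrals[OF D]) simp
  then have real: "F (ereal x) = G (ereal x)" for x by (simp add: D_def)
  have "((\<lambda>x. F (ereal x)) \<longlongrightarrow> G \<infinity>) at_top" unfolding real by (rule Bc_real(2)[OF G])
  then have "F \<infinity> = G \<infinity>" by (rule tendsto_unique[OF _ Bc_real(2)[OF F], rotated]) simp
  moreover have "F (-\<infinity>) = G (-\<infinity>)" using F G by (simp add: Bc_def)
  ultimately show "F = G"
    using real by (intro ext) (metis ereal_cases)
qed

section \<open>Well-definedness of the integral of the product\<close>

lemma primitive_nth_deriv:
  assumes "F \<in> Bc"
  shows "primitive n (nth_deriv n F) = F"
  unfolding primitive_def using assms by (intro the_equality) (auto intro: nth_deriv_inject)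

text \<open>By \<open>iter_int_inject\<close> two versions differ at countably many real points
  only, so they agree on a dense set, and their values at \<infinity> are limits along it.\<close>

lemma IBV_deriv_unique_dense:
  assumes "IBV_deriv m h g" "IBV_deriv m h g'"
  shows "dense_set {x. g (ereal x) = g' (ereal x)}" "g \<infinity> = g' \<infinity>"
proof -
  have BV: "g \<in> BV" "g' \<in> BV" using assms by (auto simp: IBV_deriv_def)
  have "iter_int m (\<lambda>x. g (ereal x)) = iter_int m (\<lambda>x. g' (ereal x))"
    using assms by (simp add: IBV_deriv_def)
  from iter_int_inject[OF tame_BV[OF BV(1)] tame_BV[OF BV(2)] this]
  show D: "dense_set {x. g (ereal x) = g' (ereal x)}"
    by (intro dense_set_co_countable) (simp add: Collect_neg_eq[symmetric])
  show "g \<infinity> = g' \<infinity>"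
    by (rule tendsto_unique_dense[OF D, of "\<lambda>x. g (ereal x)" "\<lambda>x. g' (ereal x)"])
       (use BV in \<open>auto simp: BV_def\<close>)
qed

text \<open>The definite description ranges over all versions \<open>g\<close> and their integrals
  \<open>s\<close>; since \<open>s\<close> and \<open>g \<infinity>\<close> are the same for every
  version, any one pair evaluates it.\<close>

lemma distr_integral_prod_eqI:
  assumes "F \<in> Bc" and g: "IBV_deriv (n - 1) h g" and s: "has_RS_integral_ereal F g s"
  shows "distr_integral_prod n (nth_deriv n F) h = (-1) ^ (n - 1) * (F \<infinity> * g \<infinity> - s)"
  unfolding distr_integral_prod_def primitive_nth_deriv[OF \<open>F \<in> Bc\<close>]
proof (rule the_equality)
  show "\<exists>g' s'. IBV_deriv (n - 1) h g' \<and> has_RS_integral_ereal F g' s' \<and>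
      (-1) ^ (n - 1) * (F \<infinity> * g \<infinity> - s) = (-1) ^ (n - 1) * (F \<infinity> * g' \<infinity> - s')"
    using g s by (intro exI[of _ g] exI[of _ s] conjI refl)
  fix v
  assume "\<exists>g' s'. IBV_deriv (n - 1) h g' \<and> has_RS_integral_ereal F g' s' \<and>
      v = (-1) ^ (n - 1) * (F \<infinity> * g' \<infinity> - s')"
  then obtain g' s' where g': "IBV_deriv (n - 1) h g'" and s': "has_RS_integral_ereal F g' s'"
    and v: "v = (-1) ^ (n - 1) * (F \<infinity> * g' \<infinity> - s')" by blast
  have "s = s'"
    using IBV_deriv_unique_dense(1)[OF g g'] s s' by (rule has_RS_integral_ereal_unique_dense) simp
  moreover have "g \<infinity> = g' \<infinity>" by (rule IBV_deriv_unique_dense(2)[OF g g'])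
  ultimately show "v = (-1) ^ (n - 1) * (F \<infinity> * g \<infinity> - s)" by (simp add: v)
qed

theorem theorem14:
  fixes n :: nat and F :: "ereal \<Rightarrow> real" and h :: "real \<Rightarrow> real" and g :: "ereal \<Rightarrow> real"
  assumes "n \<ge> 1"
    and "F \<in> Bc"
    and "h \<in> IBV (n - 1)"
    and "IBV_deriv (n - 1) h g"
    and "mono g \<or> antimono g"
  shows "\<exists>\<xi>::ereal. distr_integral_prod n (nth_deriv n F) h =
           (-1) ^ (n - 1) * (g (-\<infinity>) * distr_integral (nth_deriv 1 F) (-\<infinity>) \<xi>
                             + g \<infinity> * distr_integral (nth_deriv 1 F) \<xi> \<infinity>)"
proof -
  have "continuous_on UNIV F" and F0: "F (-\<infinity>) = 0"
    using \<open>F \<in> Bc\<close> by (auto simp: Bc_def)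
  moreover have "g \<in> BV" using \<open>IBV_deriv (n - 1) h g\<close> by (simp add: IBV_deriv_def)
  ultimately obtain \<xi> where "has_RS_integral_ereal F g (F \<xi> * (g \<infinity> - g (-\<infinity>)))"
    using RS_mean_value \<open>mono g \<or> antimono g\<close> by blast
  then have "distr_integral_prod n (nth_deriv n F) h =
      (-1) ^ (n - 1) * (F \<infinity> * g \<infinity> - F \<xi> * (g \<infinity> - g (-\<infinity>)))"
    by (rule distr_integral_prod_eqI[OF \<open>F \<in> Bc\<close> \<open>IBV_deriv (n - 1) h g\<close>])
  \<comment> \<open>Grouping by the two end values of \<open>g\<close> leaves increments of
    \<open>F\<close> as coefficients, with \<open>F (-\<infinity>) = 0\<close> completing the first
    one.\<close>
  also have "F \<infinity> * g \<infinity> - F \<xi> * (g \<infinity> - g (-\<infinity>)) =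
      g (-\<infinity>) * (F \<xi> - F (-\<infinity>)) + g \<infinity> * (F \<infinity> - F \<xi>)"
    by (simp add: F0 algebra_simps)
  finally show ?thesis
    by (auto simp: distr_integral_def primitive_nth_deriv[OF \<open>F \<in> Bc\<close>])
qed

end
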